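(* Let $(G,\theta)$ be a reductive symmetric pair with variety of reductions $\mathfrak{R}$, and let $\mathfrak{R}_{\mathrm{I}}$ and $\mathfrak{R}_{\mathrm{II}}$ be $K$-orbits in $\mathfrak{R}$. If $\mathfrak{R}_{\mathrm{I}}$ is more general than $\mathfrak{R}_{\mathrm{II}}$ and $\mathfrak{R}_{\mathrm{II}}$ is regular, then $\mathfrak{R}_{\mathrm{I}}$ is regular and the decomposition class associated with $\mathfrak{R}_{\mathrm{I}}$ is more general than the decomposition class associated with $\mathfrak{R}_{\mathrm{II}}$.
   Context: All groups and varieties are over $\mathbb{C}$. A reductive symmetric pair $(G,\theta)$ consists of a reductive complex algebraic group $G$ and an involution $\theta$ of $G$. Put $K=(G^\theta)^\circ$. The differential of $\theta$ decomposes the Lie algebra as $\mathfrak{g}=\mathfrak{k}\oplus\mathfrak{p}$ ($+1$ and $-1$ eigenspaces). A Cartan subspace of $\mathfrak{p}$ is a linear subspace of $\mathfrak{g}$ contained in $\mathfrak{p}$ and in some Cartan subalgebra of $\mathfrak{g}$, and maximal for inclusion among such subspaces. All Cartan subspaces are $K$-conjugate, of common dimension $r$, the rank of the pair. The variety of reductions $\mathfrak{R}$ is the closure in $\mathrm{Gr}(r,\mathfrak{p})$ of the set of all Cartan subspaces. For $u\in\mathfrak{p}$, $\mathfrak{c}_{\mathfrak{p}}(u)$ is its centralizer in $\mathfrak{p}$; $u$ is regular when $\dim \mathfrak{c}_{\mathfrak{p}}(u)$ is minimal, in which case $\mathfrak{c}_{\mathfrak{p}}(u)\in\mathfrak{R}$.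 The centralizer map is $\mathcal{C}:u\mapsto\mathfrak{c}_{\mathfrak{p}}(u)$ from the set of regular elements to $\mathfrak{R}$. A reduction (point of $\mathfrak{R}$) is regular if it is in the image of $\mathcal{C}$, and a $K$-orbit in $\mathfrak{R}$ is regular if it passes through a regular reduction. Two elements $u=u_s+u_n$ and $v=v_s+v_n$ of $\mathfrak{p}$ (Chevalley–Jordan decompositions) have the same decomposition class when there is $g\in K$ with $g\cdot\mathfrak{c}_{\mathfrak{p}}(u_s)=\mathfrak{c}_{\mathfrak{p}}(v_s)$ and $g u_n=v_n$ (equivalently, $\mathfrak{c}_{\mathfrak{p}}(u)$ and $\mathfrak{c}_{\mathfrak{p}}(v)$ are $K$-conjugate). The equivalence classes are the decomposition classes in $\mathfrak{p}$. The decomposition class associated with a regular orbit is the inverse image of that orbit under $\mathcal{C}$. An orbit $\mathcal{O}_1$ (resp. decomposition class $\mathcal{D}_1$) is more general than $\mathcal{O}_0$ (resp. $\mathcal{D}_0$) when $\mathcal{O}_0$ (resp. $\mathcal{D}_0$) is contained in the closure of $\mathcal{O}_1$ (resp. $\mathcal{D}_1$). *)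

theory Defs
  imports "HOL-Analysis.Analysis" "HOL-Algebra.Coset" "HOL-Algebra.Group_Action"
begin

section \<open>Polynomial functions and Zariski topologies\<close>

text \<open>The algebra of functions generated by a set \<open>C\<close> of coordinate functions. A space is viewed
  as an affine variety through its set of coordinate functions.\<close>

inductive_set polynomial_functions :: "('a \<Rightarrow> complex) set \<Rightarrow> ('a \<Rightarrow> complex) set"
  for C :: "('a \<Rightarrow> complex) set" where
  const: "(\<lambda>x. c) \<in> polynomial_functions C"
| coord: "f \<in> C \<Longrightarrow> f \<in> polynomial_functions C"
| add: "f \<in> polynomial_functions C \<Longrightarrow> g \<in> polynomial_functions C \<Longrightarrow>
    (\<lambda>x. f x + g x) \<in> polynomial_functions C"
| mult: "f \<in> polynomial_functions C \<Longrightarrow> g \<in> polynomial_functions C \<Longrightarrow>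
    (\<lambda>x. f x * g x) \<in> polynomial_functions C"

definition zariski :: "('a \<Rightarrow> complex) set \<Rightarrow> 'a topology" where
  "zariski C = topology_generated_by {{x. f x \<noteq> 0} | f. f \<in> polynomial_functions C}"


section \<open>Complex matrices\<close>

type_synonym 'n cmat = "complex ^ 'n ^ 'n"

text \<open>The library only provides the real vector space structure on this type.\<close>

definition cscale :: "complex \<Rightarrow> 'n::finite cmat \<Rightarrow> 'n cmat" where
  "cscale c A = (\<chi> i j. c * A $ i $ j)"

interpretation cmat: vector_space cscale
  by standard (simp_all add: cscale_def vec_eq_iff algebra_simps)

definition entries :: "('n::finite cmat \<Rightarrow> complex) set" where
  "entries = {(\<lambda>A. A $ i $ j) | i j. True}"

abbreviation zariski_mat :: "'n::finite cmat topology" where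
  "zariski_mat \<equiv> zariski entries"

definition GL :: "'n::finite cmat monoid" where
  "GL = \<lparr>carrier = {A. invertible A}, monoid.mult = (**), one = mat 1\<rparr>"

abbreviation GL_sub :: "'n::finite cmat set \<Rightarrow> 'n cmat monoid" where
  "GL_sub H \<equiv> GL\<lparr>carrier := H\<rparr>"

definition nilpotent_mat :: "'n::finite cmat \<Rightarrow> bool" where
  "nilpotent_mat X \<longleftrightarrow> (\<exists>k. (((**) X) ^^ k) (mat 1) = 0)"

definition semisimple_mat :: "'n::finite cmat \<Rightarrow> bool" where
  "semisimple_mat X \<longleftrightarrow>
    (\<exists>P :: 'n cmat. invertible P \<and> (\<forall>i j. i \<noteq> j \<longrightarrow> (P ** X ** matrix_inv P) $ i $ j = 0))"

definition bracket :: "'n::finite cmat \<Rightarrow> 'n cmat \<Rightarrow> 'n cmat" where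
  "bracket X Y = X ** Y - Y ** X"


section \<open>Reductive symmetric pairs\<close>

text \<open>Complex linear algebraic groups are realised as Zariski closed subgroups of
  \<open>GL\<^sub>n(\<complex>)\<close>, with \<open>n\<close> the (arbitrary) cardinality of the index type.\<close>

definition algebraic_group :: "'n::finite cmat set \<Rightarrow> bool" where
  "algebraic_group H \<longleftrightarrow>
    subgroup H GL \<and> closedin (subtopology zariski_mat (carrier GL)) H"

text \<open>Triviality of the unipotent radical; connectedness of \<open>G\<close> is not required.\<close>

definition reductive_group :: "'n::finite cmat set \<Rightarrow> bool" where
  "reductive_group G \<longleftrightarrow> algebraic_group G \<and>
    (\<forall>N. algebraic_group N \<and> normal N (GL_sub G) \<and> connectedin zariski_mat N \<and>
         (\<forall>A\<in>N. nilpotent_mat (A - mat 1)) \<longrightarrow> N = {mat 1})"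

text \<open>The coordinate ring of \<open>GL\<^sub>n(\<complex>)\<close> is generated by the entries and the inverse
  determinant; regular functions on a closed subgroup are restrictions of its elements.\<close>

definition regular_functions :: "('n::finite cmat \<Rightarrow> complex) set" where
  "regular_functions = polynomial_functions (entries \<union> {\<lambda>A. inverse (det A)})"

definition regular_extension ::
    "'n::finite cmat set \<Rightarrow> ('n cmat \<Rightarrow> 'n cmat) \<Rightarrow> ('n cmat \<Rightarrow> 'n cmat) \<Rightarrow> bool" where
  "regular_extension G \<theta> F \<longleftrightarrow>
    (\<forall>i j. (\<lambda>A. F A $ i $ j) \<in> regular_functions) \<and> (\<forall>A\<in>G. F A = \<theta> A)"

definition reductive_symmetric_pair ::
    "'n::finite cmat set \<Rightarrow> ('n cmat \<Rightarrow> 'n cmat) \<Rightarrow> bool" where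
  "reductive_symmetric_pair G \<theta> \<longleftrightarrow> reductive_group G \<and>
    \<theta> \<in> hom (GL_sub G) (GL_sub G) \<and> (\<exists>F. regular_extension G \<theta> F) \<and>
    (\<forall>A\<in>G. \<theta> (\<theta> A) = A)"

definition identity_component :: "'n::finite cmat set \<Rightarrow> 'n cmat set" where
  "identity_component H = connected_component_of_set (subtopology zariski_mat H) (mat 1)"

definition fixed_group ::
    "'n::finite cmat set \<Rightarrow> ('n cmat \<Rightarrow> 'n cmat) \<Rightarrow> 'n cmat set" where
  "fixed_group G \<theta> = identity_component {A \<in> G. \<theta> A = A}"

text \<open>The Zariski tangent space at the identity.\<close>

definition lie_algebra :: "'n::finite cmat set \<Rightarrow> 'n cmat set" where
  "lie_algebra G = {X. \<forall>f \<in> polynomial_functions entries. (\<forall>A\<in>G. f A = 0) \<longrightarrow>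
     ((\<lambda>t. f (mat 1 + cscale t X)) has_field_derivative 0) (at 0)}"

text \<open>The differential of a morphism at the identity. It is meaningful on \<^term>\<open>lie_algebra G\<close>,
  where it does not depend on the extension of \<open>\<theta>\<close> to a regular map on \<open>GL\<^sub>n(\<complex>)\<close>.\<close>

definition differential ::
    "'n::finite cmat set \<Rightarrow> ('n cmat \<Rightarrow> 'n cmat) \<Rightarrow> 'n cmat \<Rightarrow> 'n cmat" where
  "differential G \<theta> X = (let F = (SOME F. regular_extension G \<theta> F) in
     (\<chi> i j. deriv (\<lambda>t. F (mat 1 + cscale t X) $ i $ j) 0))"

definition anti_invariants ::
    "'n::finite cmat set \<Rightarrow> ('n cmat \<Rightarrow> 'n cmat) \<Rightarrow> 'n cmat set" where
  "anti_invariants G \<theta> = {X \<in> lie_algebra G. differential G \<theta> X = - X}"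


section \<open>Cartan subspaces\<close>

text \<open>The Lie algebra of a reductive group is a reductive Lie algebra; its Cartan subalgebras are
  taken to be its maximal toral subalgebras, that is, the abelian subalgebras consisting of
  semisimple elements that are maximal among these. Semisimplicity of an element of the Lie algebra
  of a linear algebraic group is diagonalisability as a matrix.\<close>

definition toral_subalgebra :: "'n::finite cmat set \<Rightarrow> 'n cmat set \<Rightarrow> bool" where
  "toral_subalgebra L H \<longleftrightarrow> cmat.subspace H \<and> H \<subseteq> L \<and>
    (\<forall>X\<in>H. \<forall>Y\<in>H. bracket X Y = 0) \<and> (\<forall>X\<in>H. semisimple_mat X)"

definition cartan_subalgebra :: "'n::finite cmat set \<Rightarrow> 'n cmat set \<Rightarrow> bool" where
  "cartan_subalgebra L H \<longleftrightarrow> toral_subalgebra L H \<and>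
    (\<forall>H'. toral_subalgebra L H' \<and> H \<subseteq> H' \<longrightarrow> H' = H)"

definition in_p_and_cartan ::
    "'n::finite cmat set \<Rightarrow> ('n cmat \<Rightarrow> 'n cmat) \<Rightarrow> 'n cmat set \<Rightarrow> bool" where
  "in_p_and_cartan G \<theta> A \<longleftrightarrow> cmat.subspace A \<and> A \<subseteq> anti_invariants G \<theta> \<and>
    (\<exists>H. cartan_subalgebra (lie_algebra G) H \<and> A \<subseteq> H)"

definition cartan_subspace ::
    "'n::finite cmat set \<Rightarrow> ('n cmat \<Rightarrow> 'n cmat) \<Rightarrow> 'n cmat set \<Rightarrow> bool" where
  "cartan_subspace G \<theta> A \<longleftrightarrow> in_p_and_cartan G \<theta> A \<and>
    (\<forall>B. in_p_and_cartan G \<theta> B \<and> A \<subseteq> B \<longrightarrow> B = A)"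

text \<open>All Cartan subspaces have the same dimension, so the choice does not matter.\<close>

definition pair_rank :: "'n::finite cmat set \<Rightarrow> ('n cmat \<Rightarrow> 'n cmat) \<Rightarrow> nat" where
  "pair_rank G \<theta> = cmat.dim (SOME A. cartan_subspace G \<theta> A)"


section \<open>Grassmannians\<close>

definition grassmannian :: "nat \<Rightarrow> 'n::finite cmat set \<Rightarrow> 'n cmat set set" where
  "grassmannian r V = {W. cmat.subspace W \<and> W \<subseteq> V \<and> cmat.dim W = r}"

text \<open>The Zariski topology on the Grassmannian is the quotient topology for the
  \<open>GL\<^sub>r\<close>-bundle of frames, which is an open subvariety of \<open>V\<^sup>r\<close>.\<close>

definition frame_entries :: "nat \<Rightarrow> ((nat \<Rightarrow> 'n::finite cmat) \<Rightarrow> complex) set" where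
  "frame_entries r = {(\<lambda>v. v k $ i $ j) | k i j. k < r}"

definition frames :: "nat \<Rightarrow> 'n::finite cmat set \<Rightarrow> (nat \<Rightarrow> 'n cmat) set" where
  "frames r V = {v \<in> {..<r} \<rightarrow>\<^sub>E V. inj_on v {..<r} \<and> cmat.independent (v ` {..<r})}"

definition grassmann_topology :: "nat \<Rightarrow> 'n::finite cmat set \<Rightarrow> 'n cmat set topology" where
  "grassmann_topology r V = topology (\<lambda>S. S \<subseteq> grassmannian r V \<and>
     openin (subtopology (zariski (frame_entries r)) (frames r V))
       {v \<in> frames r V. cmat.span (v ` {..<r}) \<in> S})"

lemma openin_grassmann_topology:
  "openin (grassmann_topology r V) S \<longleftrightarrow> S \<subseteq> grassmannian r V \<and>
     openin (subtopology (zariski (frame_entries r)) (frames r V))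
       {v \<in> frames r V. cmat.span (v ` {..<r}) \<in> S}"
proof -
  let ?T = "subtopology (zariski (frame_entries r)) (frames r V)"
  let ?pre = "\<lambda>S. {v \<in> frames r V. cmat.span (v ` {..<r}) \<in> S}"
  have "istopology (\<lambda>S. S \<subseteq> grassmannian r V \<and> openin ?T (?pre S))"
    unfolding istopology_def
  proof (intro conjI allI impI)
    fix S S' assume S: "S \<subseteq> grassmannian r V \<and> openin ?T (?pre S)"
      and S': "S' \<subseteq> grassmannian r V \<and> openin ?T (?pre S')"
    have "?pre (S \<inter> S') = ?pre S \<inter> ?pre S'" by auto
    then show "openin ?T (?pre (S \<inter> S'))" using S S' by (simp add: openin_Int)
    show "S \<inter> S' \<subseteq> grassmannian r V" using S by blast
  next
    fix K assume K: "\<forall>S\<in>K. S \<subseteq> grassmannian r V \<and> openin ?T (?pre S)"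
    have "?pre (\<Union>K) = \<Union>(?pre ` K)" by auto
    then show "openin ?T (?pre (\<Union>K))" using K by auto
    show "\<Union>K \<subseteq> grassmannian r V" using K by blast
  qed
  then show ?thesis unfolding grassmann_topology_def by (simp add: topology_inverse')
qed


section \<open>The variety of reductions\<close>

definition pair_grassmann_topology ::
    "'n::finite cmat set \<Rightarrow> ('n cmat \<Rightarrow> 'n cmat) \<Rightarrow> 'n cmat set topology" where
  "pair_grassmann_topology G \<theta> = grassmann_topology (pair_rank G \<theta>) (anti_invariants G \<theta>)"

definition reductions ::
    "'n::finite cmat set \<Rightarrow> ('n cmat \<Rightarrow> 'n cmat) \<Rightarrow> 'n cmat set set" where
  "reductions G \<theta> = pair_grassmann_topology G \<theta> closure_of {A. cartan_subspace G \<theta> A}"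

definition conj_action :: "'n::finite cmat \<Rightarrow> 'n cmat set \<Rightarrow> 'n cmat set" where
  "conj_action g W = (\<lambda>X. g ** X ** matrix_inv g) ` W"

definition reduction_orbits ::
    "'n::finite cmat set \<Rightarrow> ('n cmat \<Rightarrow> 'n cmat) \<Rightarrow> 'n cmat set set set" where
  "reduction_orbits G \<theta> = orbits (GL_sub (fixed_group G \<theta>)) (reductions G \<theta>) conj_action"

definition centralizer_p ::
    "'n::finite cmat set \<Rightarrow> ('n cmat \<Rightarrow> 'n cmat) \<Rightarrow> 'n cmat \<Rightarrow> 'n cmat set" where
  "centralizer_p G \<theta> u = {X \<in> anti_invariants G \<theta>. bracket X u = 0}"

definition regular_elements ::
    "'n::finite cmat set \<Rightarrow> ('n cmat \<Rightarrow> 'n cmat) \<Rightarrow> 'n cmat set" where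
  "regular_elements G \<theta> = {u \<in> anti_invariants G \<theta>. \<forall>v \<in> anti_invariants G \<theta>.
     cmat.dim (centralizer_p G \<theta> u) \<le> cmat.dim (centralizer_p G \<theta> v)}"

definition regular_reductions ::
    "'n::finite cmat set \<Rightarrow> ('n cmat \<Rightarrow> 'n cmat) \<Rightarrow> 'n cmat set set" where
  "regular_reductions G \<theta> = reductions G \<theta> \<inter> centralizer_p G \<theta> ` regular_elements G \<theta>"

definition regular_orbit ::
    "'n::finite cmat set \<Rightarrow> ('n cmat \<Rightarrow> 'n cmat) \<Rightarrow> 'n cmat set set \<Rightarrow> bool" where
  "regular_orbit G \<theta> \<O> \<longleftrightarrow> \<O> \<inter> regular_reductions G \<theta> \<noteq> {}"

text \<open>The inverse image of an orbit under the centralizer map, which is only defined on the set of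
  regular elements.\<close>

definition associated_class ::
    "'n::finite cmat set \<Rightarrow> ('n cmat \<Rightarrow> 'n cmat) \<Rightarrow> 'n cmat set set \<Rightarrow> 'n cmat set" where
  "associated_class G \<theta> \<O> = {u \<in> regular_elements G \<theta>. centralizer_p G \<theta> u \<in> \<O>}"

definition orbit_more_general ::
    "'n::finite cmat set \<Rightarrow> ('n cmat \<Rightarrow> 'n cmat) \<Rightarrow> 'n cmat set set \<Rightarrow> 'n cmat set set \<Rightarrow> bool" where
  "orbit_more_general G \<theta> \<O>\<^sub>1 \<O>\<^sub>0 \<longleftrightarrow> \<O>\<^sub>0 \<subseteq> pair_grassmann_topology G \<theta> closure_of \<O>\<^sub>1"

definition class_more_general ::
    "'n::finite cmat set \<Rightarrow> ('n cmat \<Rightarrow> 'n cmat) \<Rightarrow> 'n cmat set \<Rightarrow> 'n cmat set \<Rightarrow> bool" where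
  "class_more_general G \<theta> \<D>\<^sub>1 \<D>\<^sub>0 \<longleftrightarrow>
    \<D>\<^sub>0 \<subseteq> subtopology zariski_mat (anti_invariants G \<theta>) closure_of \<D>\<^sub>1"

end

theory Submission
  imports Defs
begin

text \<open>Write \<open>\<pp>\<close> for the anti-invariants and \<open>r\<close> for the rank. Two observations carry the proof.

  A reduction that contains a regular element is the centralizer of this element. Indeed, every
  reduction is commutative, because commuting is a closed condition on the Grassmannian and holds
  for Cartan subspaces (\<open>reductions_commute\<close>). So it is contained in the centralizer of each of its
  elements; for a regular element the two have the same dimension \<open>r\<close>, as soon as one regular
  reduction exists (\<open>commuting_eq_centralizer\<close>).

  Meeting a Zariski open subset of \<open>\<pp>\<close> is an open condition on a point of the
  Grassmannian (\<open>openin_grassmann_meets\<close>), and the regular elements form an open subset of \<open>\<pp>\<close>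
  because the dimension of the kernel of a linear map is upper semicontinuous
  (\<open>kernel_dim_semicontinuous\<close>, \<open>regular_elements_open\<close>).

  Now let \<open>u\<close> be regular with its centralizer in the orbit \<open>R\<^sub>I\<^sub>I\<close>, and let \<open>U\<close> be a neighbourhood of
  \<open>u\<close> in \<open>\<pp>\<close> consisting of regular elements. The centralizer of \<open>u\<close> contains \<open>u\<close>, hence meets \<open>U\<close>,
  and it lies in the closure of \<open>R\<^sub>I\<close>. So some \<open>W\<close> in \<open>R\<^sub>I\<close> meets \<open>U\<close>, in \<open>x\<close> say, and
  \<open>W\<close> is the centralizer of \<open>x\<close>. Thus \<open>x\<close> is a point of \<open>U\<close> in the decomposition class of \<open>R\<^sub>I\<close>
  (\<open>regular_elements_near_centralizer\<close>).

  An orbit is given as the orbit of a reduction \<open>W1\<close>, and \<open>W\<close> is a conjugate of it. To return from \<open>W\<close>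
  to \<open>W1\<close>, conjugation by the fixed group must preserve \<open>\<pp>\<close>
  (\<open>anti_invariants_conj\<close>). This rests on the fact that the differential of \<open>\<theta>\<close> on the Lie algebra does
  not depend on the chosen extension of \<open>\<theta>\<close>
  (\<open>regular_function_differential_vanishes\<close>).\<close>

section \<open>Polynomial functions\<close>

lemma polynomial_functions_sum:
  assumes "\<And>i. i \<in> I \<Longrightarrow> f i \<in> polynomial_functions C"
  shows "(\<lambda>x. \<Sum>i\<in>I. f i x) \<in> polynomial_functions C"
  using assms
proof (induction I rule: infinite_finite_induct)
  case (insert i I)
  then show ?case by (simp add: polynomial_functions.add)
qed (simp_all add: polynomial_functions.const)

lemma polynomial_functions_prod:
  assumes "\<And>i. i \<in> I \<Longrightarrow> f i \<in> polynomial_functions C"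
  shows "(\<lambda>x. \<Prod>i\<in>I. f i x) \<in> polynomial_functions C"
  using assms
proof (induction I rule: infinite_finite_induct)
  case (insert i I)
  then show ?case by (simp add: polynomial_functions.mult)
qed (simp_all add: polynomial_functions.const)

lemma polynomial_functions_power:
  "f \<in> polynomial_functions C \<Longrightarrow> (\<lambda>x. f x ^ k) \<in> polynomial_functions C"
  by (induction k) (simp_all add: polynomial_functions.const polynomial_functions.mult)

lemma polynomial_functions_diff:
  assumes "f \<in> polynomial_functions C" "g \<in> polynomial_functions C"
  shows "(\<lambda>x. f x - g x) \<in> polynomial_functions C"
  using polynomial_functions.add[OF assms(1)
      polynomial_functions.mult[OF polynomial_functions.const[of "-1"] assms(2)]]
  by simp

lemma polynomial_functions_compose:
  assumes "f \<in> polynomial_functions C" "\<And>c. c \<in> C \<Longrightarrow> (\<lambda>x. c (\<phi> x)) \<in> polynomial_functions D"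
  shows "(\<lambda>x. f (\<phi> x)) \<in> polynomial_functions D"
  using assms(1) by induction (auto intro: polynomial_functions.intros assms(2))

lemma polynomial_functions_mono:
  assumes "f \<in> polynomial_functions C" "C \<subseteq> D"
  shows "f \<in> polynomial_functions D"
  using assms(1) by induction (use assms(2) in \<open>auto intro: polynomial_functions.intros\<close>)

lemma polynomial_functions_det:
  fixes M :: "'a \<Rightarrow> complex ^ 'm::finite ^ 'm"
  assumes "\<And>i j. (\<lambda>x. M x $ i $ j) \<in> polynomial_functions C"
  shows "(\<lambda>x. det (M x)) \<in> polynomial_functions C"
  unfolding det_def
  by (intro polynomial_functions_sum polynomial_functions.mult polynomial_functions.const
      polynomial_functions_prod assms)

lemma entry_polynomial: "(\<lambda>A. A $ i $ j) \<in> polynomial_functions entries"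
  by (rule polynomial_functions.coord) (auto simp: entries_def)

lemma det_polynomial: "det \<in> polynomial_functions entries"
  using polynomial_functions_det[of "\<lambda>A. A", OF entry_polynomial] by simp

lemma openin_zariski_nonzero:
  "f \<in> polynomial_functions C \<Longrightarrow> openin (zariski C) {x. f x \<noteq> 0}"
  unfolding zariski_def by (rule topology_generated_by_Basis) auto

lemma topspace_zariski [simp]: "topspace (zariski C) = UNIV"
proof -
  have "openin (zariski C) {x :: 'a. (1 :: complex) \<noteq> 0}"
    by (rule openin_zariski_nonzero[OF polynomial_functions.const])
  then show ?thesis using openin_subset by fastforce
qed

text \<open>A product of two polynomial functions vanishes exactly where one of the factors does, so the
  generating sets of the Zariski topology form a base and not only a subbase.\<close>

lemma zariski_base:
  assumes "openin (zariski C) U" "x \<in> U"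
  obtains f where "f \<in> polynomial_functions C" "f x \<noteq> 0" "{y. f y \<noteq> 0} \<subseteq> U"
proof -
  have "generate_topology_on {{x. f x \<noteq> 0} | f. f \<in> polynomial_functions C} U"
    using assms(1) by (simp add: zariski_def openin_topology_generated_by_iff)
  then have "\<forall>x\<in>U. \<exists>f\<in>polynomial_functions C. f x \<noteq> 0 \<and> {y. f y \<noteq> 0} \<subseteq> U"
  proof induction
    case (Int U V)
    show ?case
    proof
      fix x assume "x \<in> U \<inter> V"
      then obtain f g where "f \<in> polynomial_functions C" "f x \<noteq> 0" "{y. f y \<noteq> 0} \<subseteq> U"
        "g \<in> polynomial_functions C" "g x \<noteq> 0" "{y. g y \<noteq> 0} \<subseteq> V"
        using Int.IH by blast
      then show "\<exists>h\<in>polynomial_functions C. h x \<noteq> 0 \<and> {y. h y \<noteq> 0} \<subseteq> U \<inter> V"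
        by (intro bexI[of _ "\<lambda>x. f x * g x"]) (auto intro: polynomial_functions.mult)
    qed
  next
    case (UN K)
    then show ?case by blast
  qed auto
  then show ?thesis using assms(2) that by blast
qed


section \<open>Complex linear algebra of matrices\<close>

lemma cscale_nth [simp]: "cscale c A $ i $ j = c * A $ i $ j"
  by (simp add: cscale_def)

definition matrix_unit :: "'n \<Rightarrow> 'n \<Rightarrow> 'n::finite cmat" where
  "matrix_unit k l = (\<chi> i j. if i = k \<and> j = l then 1 else 0)"

lemma matrix_unit_expansion:
  "A = (\<Sum>p\<in>UNIV. cscale (A $ fst p $ snd p) (matrix_unit (fst p) (snd p)))"
proof -
  have "(\<Sum>p\<in>UNIV. cscale (A $ fst p $ snd p) (matrix_unit (fst p) (snd p))) $ i $ j
    = (\<Sum>p\<in>UNIV. if p = (i, j) then A $ i $ j else 0)" for i j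
    unfolding sum_component by (rule sum.cong) (auto simp: matrix_unit_def)
  then show ?thesis by (simp add: vec_eq_iff)
qed

interpretation cmat_fd: finite_dimensional_vector_space cscale
  "range (\<lambda>p. matrix_unit (fst p) (snd p) :: 'n::finite cmat)"
proof
  let ?E = "\<lambda>p. matrix_unit (fst p) (snd p) :: 'n cmat"
  have inj: "inj ?E"
  proof (rule injI)
    fix p q assume "?E p = ?E q"
    then have "?E p $ fst p $ snd p = ?E q $ fst p $ snd p" by simp
    then show "p = q" by (auto simp: matrix_unit_def prod_eq_iff split: if_splits)
  qed
  show "finite (range ?E)" by simp
  show "cmat.independent (range ?E)"
  proof (rule cmat.independent_if_scalars_zero)
    fix f X assume sum0: "(\<Sum>X\<in>range ?E. cscale (f X) X) = 0" and "X \<in> range ?E"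
    then obtain q where q: "X = ?E q" by blast
    have "0 = (\<Sum>p\<in>UNIV. cscale (f (?E p)) (?E p)) $ fst q $ snd q"
      using sum0 sum.reindex[OF inj, of "\<lambda>X. cscale (f X) X"] by (simp add: o_def)
    also have "\<dots> = (\<Sum>p\<in>UNIV. if p = q then f (?E q) else 0)"
      unfolding sum_component
      by (rule sum.cong) (auto simp: matrix_unit_def prod_eq_iff)
    finally show "f X = 0" using q by simp
  qed simp
  show "cmat.span (range ?E) = UNIV"
  proof (rule UNIV_eq_I[symmetric])
    fix A :: "'n cmat"
    show "A \<in> cmat.span (range ?E)"
      by (subst matrix_unit_expansion)
        (intro cmat.span_sum cmat.span_scale cmat.span_base, simp)
  qed
qed

interpretation cmat_pair: finite_dimensional_vector_space_pair cscale
  "range (\<lambda>p. matrix_unit (fst p) (snd p) :: 'n::finite cmat)" cscale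
  "range (\<lambda>p. matrix_unit (fst p) (snd p) :: 'n::finite cmat)" ..

abbreviation clinear :: "('n::finite cmat \<Rightarrow> 'n cmat) \<Rightarrow> bool" where
  "clinear \<equiv> Vector_Spaces.linear cscale cscale"

lemma clinearI:
  assumes "\<And>X Y. T (X + Y) = T X + T Y" "\<And>c X. T (cscale c X) = cscale c (T X)"
  shows "clinear T"
  by (simp add: Vector_Spaces.linear_iff cmat.vector_space_axioms assms)

lemma clinear_add: "clinear T \<Longrightarrow> T (X + Y) = T X + T Y"
  and clinear_cscale: "clinear T \<Longrightarrow> T (cscale c X) = cscale c (T X)"
  by (simp_all add: Vector_Spaces.linear_iff)

lemma clinear_sum: "clinear T \<Longrightarrow> T (\<Sum>i\<in>I. f i) = (\<Sum>i\<in>I. T (f i))"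
  by (rule cmat_pair.linear_sum)

text \<open>The function \<open>f\<close> is the determinant of \<open>T u\<close> in the basis of matrix units.\<close>

lemma injective_generic:
  fixes T :: "'a \<Rightarrow> 'n::finite cmat \<Rightarrow> 'n cmat"
  assumes lin: "\<And>u. clinear (T u)"
    and poly: "\<And>X i j. (\<lambda>u. T u X $ i $ j) \<in> polynomial_functions C"
    and inj: "\<forall>X. T u0 X = 0 \<longrightarrow> X = 0"
  shows "\<exists>f\<in>polynomial_functions C. f u0 \<noteq> 0 \<and>
    (\<forall>u. f u \<noteq> 0 \<longrightarrow> (\<forall>X. T u X = 0 \<longrightarrow> X = 0))"
proof -
  define vec where "vec X = (\<chi> p. X $ fst p $ snd p)" for X :: "'n cmat"
  define M where "M u = (\<chi> p q. T u (matrix_unit (fst q) (snd q)) $ fst p $ snd p)" for u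
  have vec_0: "vec X = 0 \<longleftrightarrow> X = 0" for X
    by (auto simp: vec_def vec_eq_iff)
  have M_vec: "M u *v vec X = vec (T u X)" for u X
  proof -
    have "T u X = (\<Sum>q\<in>UNIV. cscale (X $ fst q $ snd q) (T u (matrix_unit (fst q) (snd q))))"
      by (subst (1) matrix_unit_expansion[of X])
        (simp add: clinear_sum[OF lin] clinear_cscale[OF lin])
    then show ?thesis
      by (simp add: vec_eq_iff vec_def M_def matrix_vector_mult_def mult.commute)
  qed
  have surj: "\<exists>X. x = vec X" for x
    by (rule exI[of _ "\<chi> i j. x $ (i, j)"]) (simp add: vec_def vec_eq_iff)
  have det_iff: "det (M u) \<noteq> 0 \<longleftrightarrow> (\<forall>X. T u X = 0 \<longrightarrow> X = 0)" for u
  proof -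
    have "det (M u) \<noteq> 0 \<longleftrightarrow> (\<forall>x. M u *v x = 0 \<longrightarrow> x = 0)"
      by (metis invertible_det_nz invertible_left_inverse matrix_left_invertible_ker)
    also have "\<dots> \<longleftrightarrow> (\<forall>X. T u X = 0 \<longrightarrow> X = 0)"
      by (metis surj M_vec vec_0)
    finally show ?thesis .
  qed
  have "(\<lambda>u. det (M u)) \<in> polynomial_functions C"
    by (rule polynomial_functions_det) (simp add: M_def poly)
  then show ?thesis
    using det_iff inj by (intro bexI[of _ "\<lambda>u. det (M u)"]) blast+
qed

text \<open>A linear map that is injective on a subspace becomes injective everywhere after it is
  replaced on a complement of the subspace: a basis of the subspace and its image extend to two
  bases of the whole space, and the added vectors are in bijection.\<close>

lemma injective_on_subspace_completion:
  assumes T: "clinear T" and S: "cmat.subspace S" and inj: "\<forall>X\<in>S. T X = 0 \<longrightarrow> X = 0"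
  shows "\<exists>P N. clinear P \<and> clinear N \<and> (\<forall>X\<in>S. P X = X) \<and> (\<forall>X\<in>S. N X = 0) \<and>
    (\<forall>X. T (P X) + N X = 0 \<longrightarrow> X = 0)"
proof -
  obtain B0 where B0: "B0 \<subseteq> S" "cmat.independent B0" "cmat.span B0 = S"
    by (rule cmat_fd.basis_subspace_exists[OF S]) blast
  define B where "B = cmat.extend_basis B0"
  define D0 where "D0 = T ` B0"
  define D where "D = cmat.extend_basis D0"
  have inj_S: "inj_on T S"
  proof (rule inj_onI)
    fix X Y assume "X \<in> S" "Y \<in> S" "T X = T Y"
    then show "X = Y"
      using bspec[OF inj, of "X - Y"] cmat.subspace_diff[OF S] cmat_pair.linear_diff[OF T] by simp
  qed
  have D0: "cmat.independent D0"
    unfolding D0_def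
    by (rule cmat_pair.linear_independent_injective_image[OF T B0(2)]) (simp add: B0 inj_S)
  have B: "B0 \<subseteq> B" "cmat.independent B" "cmat.span B = UNIV"
    and D: "D0 \<subseteq> D" "cmat.independent D" "cmat.span D = UNIV"
    using B0 D0 by (simp_all add: B_def D_def cmat.extend_basis_superset
        cmat.independent_extend_basis)
  have fin: "finite B" "finite D"
    using B D cmat_fd.finiteI_independent by blast+
  have "card B = card D"
    using B D cmat.dim_eq_card[of B UNIV] cmat.dim_eq_card[of D UNIV] by simp
  moreover have "card D0 = card B0"
    unfolding D0_def using inj_S B0(1) by (meson card_image inj_on_subset)
  ultimately have "card (B - B0) = card (D - D0)"
    using B(1) D(1) fin by (simp add: card_Diff_subset finite_subset)
  then obtain h where h: "bij_betw h (B - B0) (D - D0)"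
    using finite_same_card_bij[of "B - B0" "D - D0"] fin by auto
  define P where "P = cmat_pair.construct B (\<lambda>b. if b \<in> B0 then b else 0)"
  define N where "N = cmat_pair.construct B (\<lambda>b. if b \<in> B0 then 0 else h b)"
  have lin: "clinear P" "clinear N"
    unfolding P_def N_def by (intro cmat_pair.linear_construct B)+
  have P_b: "P b = (if b \<in> B0 then b else 0)" and N_b: "N b = (if b \<in> B0 then 0 else h b)"
    if "b \<in> B" for b
    unfolding P_def N_def using that B by (simp_all add: cmat_pair.construct_basis)
  have P_id: "P X = X" if "X \<in> S" for X
    using cmat_pair.linear_eq_on[OF lin(1) cmat.linear_id, of X B0] that B0(3) P_b B(1)
    by (metis id_apply subsetD)
  have N_0: "N X = 0" if "X \<in> S" for X
    using cmat_pair.linear_eq_0_on_span[OF lin(2), of B0 X] that B0(3) N_b B(1) by (metis subsetD)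
  define Q where "Q X = T (P X) + N X" for X
  have Q: "clinear Q"
    by (rule clinearI)
      (simp_all add: Q_def clinear_add[OF T] clinear_add[OF lin(1)] clinear_add[OF lin(2)]
        clinear_cscale[OF T] clinear_cscale[OF lin(1)] clinear_cscale[OF lin(2)]
        cmat.scale_right_distrib)
  have Q_b: "Q b = (if b \<in> B0 then T b else h b)" if "b \<in> B" for b
    using that P_b N_b cmat_pair.linear_0[OF T] by (simp add: Q_def)
  have img: "Q ` B = D"
  proof -
    have "Q ` B = Q ` B0 \<union> Q ` (B - B0)" using B(1) by blast
    also have "Q ` B0 = D0" unfolding D0_def using Q_b B(1) by (intro image_cong) auto
    also have "Q ` (B - B0) = h ` (B - B0)" using Q_b by (intro image_cong) auto
    also have "\<dots> = D - D0" using h by (simp add: bij_betw_def)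
    finally show ?thesis using D(1) by blast
  qed
  then have "inj_on Q B"
    using fin \<open>card B = card D\<close> by (simp add: eq_card_imp_inj_on)
  then have "inj_on Q (cmat.span B)"
    using cmat_pair.linear_inj_on_span_independent_image[OF Q] D(2) img by simp
  then have "X = 0" if "Q X = 0" for X
    using that cmat_pair.linear_0[OF Q] B(3) injD[of Q X 0] by simp
  then show ?thesis using lin P_id N_0 unfolding Q_def by blast
qed

text \<open>The completion found at \<open>u0\<close> is kept for all \<open>u\<close>: composing with a fixed projection and
  adding a fixed map turns \<open>T\<close> into a polynomial family of endomorphisms, to which the determinant
  applies.\<close>

lemma injective_on_subspace_generic:
  fixes T :: "'a \<Rightarrow> 'n::finite cmat \<Rightarrow> 'n cmat"
  assumes lin: "\<And>u. clinear (T u)"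
    and poly: "\<And>X i j. (\<lambda>u. T u X $ i $ j) \<in> polynomial_functions C"
    and S: "cmat.subspace S" and inj: "\<forall>X\<in>S. T u0 X = 0 \<longrightarrow> X = 0"
  shows "\<exists>f\<in>polynomial_functions C. f u0 \<noteq> 0 \<and>
    (\<forall>u. f u \<noteq> 0 \<longrightarrow> (\<forall>X\<in>S. T u X = 0 \<longrightarrow> X = 0))"
proof -
  obtain P N where PN: "clinear P" "clinear N"
    "\<forall>X\<in>S. P X = X" "\<forall>X\<in>S. N X = 0" "\<forall>X. T u0 (P X) + N X = 0 \<longrightarrow> X = 0"
    using injective_on_subspace_completion[OF lin S inj] by blast
  define Q where "Q u X = T u (P X) + N X" for u X
  have Q: "clinear (Q u)" for u
    by (rule clinearI)
      (simp_all add: Q_def clinear_add[OF lin] clinear_add[OF PN(1)] clinear_add[OF PN(2)]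
        clinear_cscale[OF lin] clinear_cscale[OF PN(1)] clinear_cscale[OF PN(2)]
        cmat.scale_right_distrib)
  have Q_poly: "(\<lambda>u. Q u X $ i $ j) \<in> polynomial_functions C" for X i j
    unfolding Q_def vector_add_component
    by (rule polynomial_functions.add[OF poly polynomial_functions.const])
  have Q_inj: "\<forall>X. Q u0 X = 0 \<longrightarrow> X = 0"
    unfolding Q_def by (rule PN(5))
  obtain f where f: "f \<in> polynomial_functions C" "f u0 \<noteq> 0"
    "\<forall>u. f u \<noteq> 0 \<longrightarrow> (\<forall>X. Q u X = 0 \<longrightarrow> X = 0)"
    using injective_generic[of Q C u0, OF Q Q_poly Q_inj] by blast
  have "X = 0" if "f u \<noteq> 0" "X \<in> S" "T u X = 0" for u X
  proof -
    have "Q u X = 0" using that PN(3,4) by (simp add: Q_def)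
    then show ?thesis using f(3) that(1) by blast
  qed
  then show ?thesis using f(1,2) by blast
qed

text \<open>If \<open>S\<close> is a complement in \<open>V\<close> of the kernel at \<open>u0\<close>, then \<open>T u\<close> stays injective on \<open>S\<close> for
  \<open>u\<close> near \<open>u0\<close>, so the kernel in \<open>V\<close> meets \<open>S\<close> trivially and cannot have become larger.\<close>

lemma kernel_dim_semicontinuous:
  fixes T :: "'a \<Rightarrow> 'n::finite cmat \<Rightarrow> 'n cmat"
  assumes lin: "\<And>u. clinear (T u)"
    and poly: "\<And>X i j. (\<lambda>u. T u X $ i $ j) \<in> polynomial_functions C"
    and V: "cmat.subspace V"
  shows "\<exists>f\<in>polynomial_functions C. f u0 \<noteq> 0 \<and>
    (\<forall>u. f u \<noteq> 0 \<longrightarrow> cmat.dim {X \<in> V. T u X = 0} \<le> cmat.dim {X \<in> V. T u0 X = 0})"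
proof -
  define Z where "Z u = {X \<in> V. T u X = 0}" for u
  have Z: "cmat.subspace (Z u)" "Z u \<subseteq> V" for u
    using cmat_pair.linear_subspace_kernel[OF lin[of u]] V
    by (auto simp: Z_def intro: cmat.subspace_inter[of V "{X. T u X = 0}", unfolded Int_def, simplified])
  obtain A where A: "A \<subseteq> Z u0" "cmat.independent A" "cmat.span A = Z u0" "card A = cmat.dim (Z u0)"
    by (rule cmat_fd.basis_subspace_exists[OF Z(1)[of u0]]) blast
  obtain B where B: "A \<subseteq> B" "B \<subseteq> V" "cmat.independent B" "V \<subseteq> cmat.span B"
    by (rule cmat.maximal_independent_subset_extend[of A V]) (use A Z(2)[of u0] in auto)
  have finB: "finite B" using B(3) cmat_fd.finiteI_independent by blast
  define S where "S = cmat.span (B - A)"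
  have S: "cmat.subspace S" "S \<subseteq> V"
    using B(2) V cmat.span_minimal[of "B - A" V] by (auto simp: S_def)
  have "cmat.independent (B - A)" using B(3) cmat.independent_mono by blast
  then have dim_S: "cmat.dim S = card B - card A"
    using B(1) finB
    by (simp add: S_def cmat.dim_eq_card_independent card_Diff_subset finite_subset)
  have card_le: "card A \<le> card B" using B(1) finB by (simp add: card_mono)
  have dim_V: "cmat.dim V = card B" using cmat.basis_card_eq_dim[OF B(2,4,3)] by simp
  have "cmat.dim {x + y |x y. x \<in> Z u0 \<and> y \<in> S} = cmat.dim V"
  proof -
    have "{x + y |x y. x \<in> Z u0 \<and> y \<in> S} = cmat.span (A \<union> (B - A))"
      unfolding cmat.span_Un A(3) S_def cmat.span_span ..
    also have "\<dots> = cmat.span B" using B(1) by (simp add: Un_absorb1)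
    finally show ?thesis using dim_V B(3) by (simp add: cmat.dim_eq_card_independent)
  qed
  then have "cmat.dim (Z u0 \<inter> S) = 0"
    using cmat_fd.dim_sums_Int[OF Z(1)[of u0] S(1)] dim_V dim_S A(4) card_le by simp
  then have "Z u0 \<inter> S \<subseteq> {0}" by simp
  then have "\<forall>X\<in>S. T u0 X = 0 \<longrightarrow> X = 0"
    using S(2) unfolding Z_def by blast
  then obtain f where f: "f \<in> polynomial_functions C" "f u0 \<noteq> 0"
    "\<forall>u. f u \<noteq> 0 \<longrightarrow> (\<forall>X\<in>S. T u X = 0 \<longrightarrow> X = 0)"
    using injective_on_subspace_generic[of T C S u0, OF lin poly S(1)] by blast
  have "cmat.dim (Z u) \<le> cmat.dim (Z u0)" if "f u \<noteq> 0" for u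
  proof -
    have "Z u \<inter> S \<subseteq> {0}" using f(3) that unfolding Z_def by blast
    then have "cmat.dim (Z u \<inter> S) = 0" by simp
    moreover have "cmat.dim {x + y |x y. x \<in> Z u \<and> y \<in> S} \<le> cmat.dim V"
      by (rule cmat_fd.dim_subset) (use Z(2) S(2) V in \<open>auto intro!: cmat.subspace_add\<close>)
    ultimately show ?thesis
      using cmat_fd.dim_sums_Int[OF Z(1)[of u] S(1)] dim_V dim_S A(4) card_le by linarith
  qed
  then show ?thesis using f(1,2) unfolding Z_def by blast
qed


section \<open>Brackets and conjugation\<close>

lemma bracket_nth:
  "bracket X Y $ i $ j = (\<Sum>k\<in>UNIV. X $ i $ k * Y $ k $ j) - (\<Sum>k\<in>UNIV. Y $ i $ k * X $ k $ j)"
  by (simp add: bracket_def matrix_matrix_mult_def)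

lemma clinear_bracket: "clinear (\<lambda>X. bracket X Y)"
  by (rule clinearI)
    (simp_all add: vec_eq_iff bracket_nth algebra_simps sum.distrib sum_distrib_left)

lemma bracket_polynomial:
  assumes "\<And>i j. (\<lambda>v. X v $ i $ j) \<in> polynomial_functions C"
    and "\<And>i j. (\<lambda>v. Y v $ i $ j) \<in> polynomial_functions C"
  shows "(\<lambda>v. bracket (X v) (Y v) $ i $ j) \<in> polynomial_functions C"
  unfolding bracket_nth
  by (intro polynomial_functions_diff polynomial_functions_sum polynomial_functions.mult assms)

lemma matrix_inv_cancel:
  fixes g :: "'n::finite cmat"
  assumes "invertible g"
  shows "g ** matrix_inv g = mat 1" "matrix_inv g ** g = mat 1"
  using someI_ex[OF assms[unfolded invertible_def]] by (simp_all add: matrix_inv_def)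

lemma clinear_conj: "clinear (\<lambda>X. g ** X ** h)"
  by (rule clinearI)
    (simp_all add: vec_eq_iff matrix_matrix_mult_def algebra_simps sum.distrib sum_distrib_left
      sum_distrib_right)

lemma conj_mult:
  fixes g :: "'n::finite cmat"
  assumes "invertible g"
  shows "(g ** X ** matrix_inv g) ** (g ** Y ** matrix_inv g) = g ** (X ** Y) ** matrix_inv g"
proof -
  have "(g ** X ** matrix_inv g) ** (g ** Y ** matrix_inv g)
    = g ** X ** (matrix_inv g ** g) ** Y ** matrix_inv g"
    by (simp only: matrix_mul_assoc)
  then show ?thesis by (simp add: matrix_inv_cancel[OF assms] matrix_mul_assoc)
qed

lemma bracket_conj:
  fixes g :: "'n::finite cmat"
  assumes "invertible g"
  shows "bracket (g ** X ** matrix_inv g) (g ** Y ** matrix_inv g) = g ** bracket X Y ** matrix_inv g"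
  by (simp add: bracket_def conj_mult[OF assms] cmat_pair.linear_diff[OF clinear_conj])

lemma inj_conj:
  fixes g :: "'n::finite cmat"
  assumes "invertible g"
  shows "inj (\<lambda>X. g ** X ** matrix_inv g)"
proof (rule inj_on_inverseI)
  fix X :: "'n cmat"
  have "matrix_inv g ** (g ** X ** matrix_inv g) ** g
    = (matrix_inv g ** g) ** X ** (matrix_inv g ** g)"
    by (simp only: matrix_mul_assoc)
  then show "matrix_inv g ** (g ** X ** matrix_inv g) ** g = X"
    by (simp add: matrix_inv_cancel[OF assms])
qed

lemma dim_image_conj:
  fixes g :: "'n::finite cmat"
  assumes "invertible g"
  shows "cmat.dim ((\<lambda>X. g ** X ** matrix_inv g) ` W) = cmat.dim W"
  by (rule cmat_pair.dim_image_eq[OF clinear_conj]) (rule inj_on_subset[OF inj_conj[OF assms]], simp)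

lemma group_GL: "group (GL :: 'n::finite cmat monoid)"
proof (rule groupI)
  fix x y z :: "'n cmat"
  assume x: "x \<in> carrier GL"
  then have inv_x: "invertible x" by (simp add: GL_def)
  show "\<one>\<^bsub>GL\<^esub> \<otimes>\<^bsub>GL\<^esub> x = x" by (simp add: GL_def)
  have "invertible (matrix_inv x)"
    using matrix_inv_cancel[OF inv_x] by (auto simp: invertible_def)
  then show "\<exists>y\<in>carrier GL. y \<otimes>\<^bsub>GL\<^esub> x = \<one>\<^bsub>GL\<^esub>"
    using matrix_inv_cancel[OF inv_x] by (auto simp: GL_def)
  assume y: "y \<in> carrier GL"
  then show "x \<otimes>\<^bsub>GL\<^esub> y \<in> carrier GL"
    using inv_x by (simp add: GL_def invertible_mult)
  show "x \<otimes>\<^bsub>GL\<^esub> y \<otimes>\<^bsub>GL\<^esub> z = x \<otimes>\<^bsub>GL\<^esub> (y \<otimes>\<^bsub>GL\<^esub> z)"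
    by (simp add: GL_def matrix_mul_assoc)
qed (auto simp: GL_def invertible_def intro: exI[of _ "mat 1"])

lemma algebraic_groupD:
  fixes G :: "'n::finite cmat set"
  assumes "algebraic_group G"
  shows "mat 1 \<in> G" "A \<in> G \<Longrightarrow> invertible A" "A \<in> G \<Longrightarrow> B \<in> G \<Longrightarrow> A ** B \<in> G"
    "A \<in> G \<Longrightarrow> matrix_inv A \<in> G"
proof -
  have sub: "subgroup G GL" using assms by (simp add: algebraic_group_def)
  show "mat 1 \<in> G" using subgroup.one_closed[OF sub] by (simp add: GL_def)
  show inv: "invertible A" if "A \<in> G" for A
    using subgroup.subset[OF sub] that by (auto simp: GL_def)
  show "A ** B \<in> G" if "A \<in> G" "B \<in> G"
    using subgroup.m_closed[OF sub that] by (simp add: GL_def)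
  show "matrix_inv A \<in> G" if "A \<in> G"
  proof -
    have "inv\<^bsub>GL\<^esub> A = matrix_inv A"
      using matrix_inv_cancel[OF inv[OF that]] inv[OF that]
      by (intro group.inv_equality[OF group_GL]) (auto simp: GL_def invertible_def)
    then show ?thesis using subgroup.m_inv_closed[OF sub that] by simp
  qed
qed


section \<open>Differentials of regular functions at the identity\<close>

text \<open>Only derivatives along lines through the identity are considered, as in the definition of the
  Lie algebra. These alone do not make \<open>D\<close> linear, so linearity is a separate requirement.\<close>

definition has_differential :: "('n::finite cmat \<Rightarrow> complex) \<Rightarrow> ('n cmat \<Rightarrow> complex) \<Rightarrow> bool" where
  "has_differential f D \<longleftrightarrow>
    (\<forall>X. ((\<lambda>t. f (mat 1 + cscale t X)) has_field_derivative D X) (at 0)) \<and>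
    (\<forall>X Y. D (X + Y) = D X + D Y) \<and> (\<forall>c X. D (cscale c X) = c * D X)"

lemma has_differentialD:
  assumes "has_differential f D"
  shows "((\<lambda>t. f (mat 1 + cscale t X)) has_field_derivative D X) (at 0)"
    "D (X + Y) = D X + D Y" "D (cscale c X) = c * D X"
  using assms by (auto simp: has_differential_def)

lemma has_differential_const: "has_differential (\<lambda>A. c) (\<lambda>X. 0)"
  by (simp add: has_differential_def)

lemma has_differential_add:
  "has_differential f D \<Longrightarrow> has_differential g E \<Longrightarrow>
    has_differential (\<lambda>A. f A + g A) (\<lambda>X. D X + E X)"
  by (auto simp: has_differential_def distrib_left intro: DERIV_add)

lemma has_differential_mult:
  assumes "has_differential f D" "has_differential g E"
  shows "has_differential (\<lambda>A. f A * g A) (\<lambda>X. D X * g (mat 1) + E X * f (mat 1))"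
proof -
  have "((\<lambda>t. f (mat 1 + cscale t X) * g (mat 1 + cscale t X)) has_field_derivative
     D X * g (mat 1) + E X * f (mat 1)) (at 0)" for X
    using DERIV_mult[OF has_differentialD(1)[OF assms(1), of X]
        has_differentialD(1)[OF assms(2), of X]] by simp
  then show ?thesis
    using has_differentialD(2,3)[OF assms(1)] has_differentialD(2,3)[OF assms(2)]
    by (simp add: has_differential_def algebra_simps)
qed

lemma has_differential_cmult:
  "has_differential f D \<Longrightarrow> has_differential (\<lambda>A. c * f A) (\<lambda>X. c * D X)"
  using has_differential_mult[OF has_differential_const[of c], of f D]
  by (simp add: mult.commute)

lemma has_differential_sum:
  assumes "\<And>i. i \<in> I \<Longrightarrow> has_differential (f i) (D i)"
  shows "has_differential (\<lambda>A. \<Sum>i\<in>I. f i A) (\<lambda>X. \<Sum>i\<in>I. D i X)"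
  using assms
proof (induction I rule: infinite_finite_induct)
  case (insert i I)
  then show ?case by (simp add: has_differential_add)
qed (simp_all add: has_differential_const)

lemma polynomial_functions_has_differential:
  assumes "f \<in> polynomial_functions C" "\<And>c. c \<in> C \<Longrightarrow> \<exists>D. has_differential c D"
  shows "\<exists>D. has_differential f D"
  using assms(1)
proof induction
  case (const c)
  then show ?case using has_differential_const by blast
next
  case (coord f)
  then show ?case using assms(2) by blast
next
  case (add f g)
  then show ?case using has_differential_add by blast
next
  case (mult f g)
  then show ?case using has_differential_mult by blast
qed

lemma polynomial_has_differential:
  assumes "f \<in> polynomial_functions entries"
  shows "\<exists>D. has_differential f D"
proof (rule polynomial_functions_has_differential[OF assms])
  fix c :: "'a cmat \<Rightarrow> complex" assume "c \<in> entries"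
  then obtain i j where c: "c = (\<lambda>A. A $ i $ j)" by (auto simp: entries_def)
  have "has_differential c (\<lambda>X. X $ i $ j)"
    unfolding has_differential_def c by (auto intro!: derivative_eq_intros)
  then show "\<exists>D. has_differential c D" by blast
qed

lemma regular_function_has_differential:
  assumes "f \<in> regular_functions"
  shows "\<exists>D. has_differential f D"
proof (rule polynomial_functions_has_differential[OF assms[unfolded regular_functions_def]])
  fix c :: "'a cmat \<Rightarrow> complex" assume "c \<in> entries \<union> {\<lambda>A. inverse (det A)}"
  then consider "c \<in> entries" | "c = (\<lambda>A. inverse (det A))" by blast
  then show "\<exists>D. has_differential c D"
  proof cases
    case 1
    then show ?thesis using polynomial_has_differential polynomial_functions.coord by blast
  next
    case 2
    obtain D where D: "has_differential (det :: 'a cmat \<Rightarrow> complex) D"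
      using polynomial_has_differential[OF det_polynomial] by blast
    have "has_differential c (\<lambda>X. - D X)"
      using DERIV_inverse'[OF has_differentialD(1)[OF D]] has_differentialD(2,3)[OF D]
      by (simp add: has_differential_def 2)
    then show ?thesis by blast
  qed
qed

text \<open>The generator \<open>inverse (det A)\<close> takes the default value \<open>0\<close> at singular matrices, whence the
  restriction to invertible \<open>A\<close>.\<close>

lemma regular_function_clear_denominator:
  assumes "f \<in> regular_functions"
  shows "\<exists>k. \<exists>P\<in>polynomial_functions entries. \<forall>A. invertible A \<longrightarrow> f A * det A ^ k = P A"
  using assms unfolding regular_functions_def
proof induction
  case (const c)
  then show ?case using polynomial_functions.const[of c] by (intro exI[of _ 0]) fastforce
next
  case (coord f)
  then consider "f \<in> entries" | "f = (\<lambda>A. inverse (det A))" by blast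
  then show ?case
  proof cases
    case 1
    then show ?thesis
      by (intro exI[of _ 0] bexI[of _ f]) (simp_all add: polynomial_functions.coord)
  next
    case 2
    then show ?thesis
      by (intro exI[of _ 1] bexI[of _ "\<lambda>A. 1"])
        (simp_all add: polynomial_functions.const invertible_det_nz)
  qed
next
  case (add f g)
  then obtain k l P Q where "P \<in> polynomial_functions entries" "Q \<in> polynomial_functions entries"
    "\<And>A. invertible A \<Longrightarrow> f A * det A ^ k = P A" "\<And>A. invertible A \<Longrightarrow> g A * det A ^ l = Q A"
    by blast
  then show ?case
    by (intro exI[of _ "k + l"] bexI[of _ "\<lambda>A. P A * det A ^ l + Q A * det A ^ k"])
      (auto simp: algebra_simps power_add
        intro!: polynomial_functions.add polynomial_functions.mult polynomial_functions_power
          det_polynomial)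
next
  case (mult f g)
  then obtain k l P Q where "P \<in> polynomial_functions entries" "Q \<in> polynomial_functions entries"
    "\<And>A. invertible A \<Longrightarrow> f A * det A ^ k = P A" "\<And>A. invertible A \<Longrightarrow> g A * det A ^ l = Q A"
    by blast
  then show ?case
    by (intro exI[of _ "k + l"] bexI[of _ "\<lambda>A. P A * Q A"])
      (auto simp: algebra_simps power_add intro!: polynomial_functions.mult)
qed

text \<open>The Lie algebra is defined by polynomial functions only; multiplying by a power of the
  determinant, which is \<open>1\<close> at the identity, carries the defining property over to regular
  functions.\<close>

lemma regular_function_differential_vanishes:
  fixes G :: "'n::finite cmat set"
  assumes G: "algebraic_group G" and f: "f \<in> regular_functions" "\<And>A. A \<in> G \<Longrightarrow> f A = 0"
    and D: "has_differential f D" and X: "X \<in> lie_algebra G"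
  shows "D X = 0"
proof -
  obtain k P where P: "P \<in> polynomial_functions entries"
    and kP: "\<And>A. invertible A \<Longrightarrow> f A * det A ^ k = P A"
    using regular_function_clear_denominator[OF f(1)] by blast
  define c where "c t = mat 1 + cscale t X" for t
  have c0: "c 0 = mat 1" by (simp add: c_def)
  have "P A = 0" if "A \<in> G" for A
    using kP[OF algebraic_groupD(2)[OF G that]] f(2)[OF that] by simp
  then have P': "((\<lambda>t. P (c t)) has_field_derivative 0) (at 0)"
    using X P unfolding lie_algebra_def c_def by blast
  obtain E where "has_differential (\<lambda>A :: 'n cmat. det A ^ k) E"
    using polynomial_has_differential[OF polynomial_functions_power[OF det_polynomial]] by blast
  from has_differentialD(1)[OF has_differential_mult[OF D this], of X]
  have fdet: "((\<lambda>t. f (c t) * det (c t) ^ k) has_field_derivative D X) (at 0)"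
    using f(2)[OF algebraic_groupD(1)[OF G]] by (simp add: c_def)
  obtain E' where "has_differential (det :: 'n cmat \<Rightarrow> complex) E'"
    using polynomial_has_differential[OF det_polynomial] by blast
  from has_differentialD(1)[OF this, of X] have "isCont (\<lambda>t. det (c t)) 0"
    unfolding c_def by (rule DERIV_isCont)
  (* The two sides of kP are only known to agree where the line consists of invertible matrices. *)
  then have "\<forall>\<^sub>F t in at 0. det (c t) \<noteq> 0"
    by (intro tendsto_imp_eventually_ne[of _ "det (c 0)"]) (auto simp: isCont_def c0)
  then have "\<forall>\<^sub>F t in nhds 0. det (c t) \<noteq> 0"
    by (simp add: eventually_nhds_conv_at c0)
  then have ev: "\<forall>\<^sub>F t in nhds 0. f (c t) * det (c t) ^ k = P (c t)"
    by eventually_elim (simp add: kP invertible_det_nz)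
  have "((\<lambda>t. P (c t)) has_field_derivative D X) (at 0)"
    by (rule DERIV_cong_ev[OF refl ev refl, THEN iffD1, OF fdet])
  then show ?thesis using P' DERIV_unique by blast
qed

lemma lie_algebra_subspace: "cmat.subspace (lie_algebra G)"
proof (rule cmat.subspaceI)
  show "0 \<in> lie_algebra G" by (simp add: lie_algebra_def)
next
  fix X Y assume X: "X \<in> lie_algebra G" and Y: "Y \<in> lie_algebra G"
  show "X + Y \<in> lie_algebra G"
    unfolding lie_algebra_def
  proof (intro CollectI ballI impI)
    fix f :: "'a cmat \<Rightarrow> complex" assume f: "f \<in> polynomial_functions entries" "\<forall>A\<in>G. f A = 0"
    obtain D where D: "has_differential f D" using polynomial_has_differential[OF f(1)] by blast
    have "D X = 0" "D Y = 0"
      using DERIV_unique[OF has_differentialD(1)[OF D]] X Y f by (auto simp: lie_algebra_def)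
    then show "((\<lambda>t. f (mat 1 + cscale t (X + Y))) has_field_derivative 0) (at 0)"
      using has_differentialD(1)[OF D, of "X + Y"] has_differentialD(2)[OF D] by simp
  qed
next
  fix c X assume X: "X \<in> lie_algebra G"
  show "cscale c X \<in> lie_algebra G"
    unfolding lie_algebra_def
  proof (intro CollectI ballI impI)
    fix f :: "'a cmat \<Rightarrow> complex" assume f: "f \<in> polynomial_functions entries" "\<forall>A\<in>G. f A = 0"
    obtain D where D: "has_differential f D" using polynomial_has_differential[OF f(1)] by blast
    have "D X = 0"
      using DERIV_unique[OF has_differentialD(1)[OF D]] X f by (auto simp: lie_algebra_def)
    then show "((\<lambda>t. f (mat 1 + cscale t (cscale c X))) has_field_derivative 0) (at 0)"
      using has_differentialD(1)[OF D, of "cscale c X"] has_differentialD(3)[OF D] by simp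
  qed
qed

lemma differential_expansion:
  assumes "\<exists>F. regular_extension G \<theta> F"
  obtains F D where "regular_extension G \<theta> F" "\<And>i j. has_differential (\<lambda>A. F A $ i $ j) (D i j)"
    "\<And>X. differential G \<theta> X = (\<chi> i j. D i j X)"
proof -
  define F where "F = (SOME F. regular_extension G \<theta> F)"
  have F: "regular_extension G \<theta> F" unfolding F_def using assms by (rule someI_ex)
  then have "\<forall>i j. \<exists>D. has_differential (\<lambda>A. F A $ i $ j) D"
    using regular_function_has_differential by (auto simp: regular_extension_def)
  then obtain D where D: "\<And>i j. has_differential (\<lambda>A. F A $ i $ j) (D i j)" by metis
  have "differential G \<theta> X = (\<chi> i j. D i j X)" for X
    unfolding differential_def F_def[symmetric] Let_def
    using DERIV_imp_deriv[OF has_differentialD(1)[OF D]] by simp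
  then show ?thesis using that F D by blast
qed

lemma anti_invariants_subspace:
  assumes "reductive_symmetric_pair G \<theta>"
  shows "cmat.subspace (anti_invariants G \<theta>)"
proof -
  obtain F D where D: "\<And>i j. has_differential (\<lambda>A. F A $ i $ j) (D i j)"
    and d: "\<And>X. differential G \<theta> X = (\<chi> i j. D i j X)"
    using differential_expansion assms unfolding reductive_symmetric_pair_def by metis
  have lin: "clinear (\<lambda>X. differential G \<theta> X + X)"
    by (rule clinearI)
      (simp_all add: d vec_eq_iff has_differentialD(2,3)[OF D] distrib_left)
  have "anti_invariants G \<theta> = lie_algebra G \<inter> {X. differential G \<theta> X + X = 0}"
    by (auto simp: anti_invariants_def eq_neg_iff_add_eq_0)
  then show ?thesis
    using cmat.subspace_inter[OF lie_algebra_subspace cmat_pair.linear_subspace_kernel[OF lin]]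
    by simp
qed


section \<open>Invariance of the anti-invariants under the fixed group\<close>

lemma conj_polynomial: "(\<lambda>A. (g ** A ** h) $ i $ j) \<in> polynomial_functions entries"
  unfolding matrix_matrix_mult_def vec_lambda_beta
  by (intro polynomial_functions_sum polynomial_functions.mult polynomial_functions.const
      entry_polynomial)

lemma conj_regular:
  fixes g :: "'n::finite cmat"
  assumes "f \<in> regular_functions" and "invertible g"
  shows "(\<lambda>A. f (g ** A ** matrix_inv g)) \<in> regular_functions"
  using assms(1) unfolding regular_functions_def
proof (rule polynomial_functions_compose)
  fix c :: "'n cmat \<Rightarrow> complex" assume "c \<in> entries \<union> {\<lambda>A. inverse (det A)}"
  then consider i j where "c = (\<lambda>A. A $ i $ j)" | "c = (\<lambda>A. inverse (det A))"
    by (auto simp: entries_def)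
  then show "(\<lambda>A. c (g ** A ** matrix_inv g)) \<in>
    polynomial_functions (entries \<union> {\<lambda>A. inverse (det A)})"
  proof cases
    case 1
    then show ?thesis by (auto intro: polynomial_functions_mono[OF conj_polynomial])
  next
    case 2
    have "det g * det (matrix_inv g) = 1"
      using matrix_inv_cancel(1)[OF assms(2)] det_mul[of g "matrix_inv g"] by simp
    then have "det (g ** A ** matrix_inv g) = det A" for A
      by (simp add: det_mul mult.commute mult.left_commute)
    then show ?thesis using 2 by (auto intro: polynomial_functions.coord)
  qed
qed

lemma lie_algebra_conj:
  assumes G: "algebraic_group G" and g: "g \<in> G" and X: "X \<in> lie_algebra G"
  shows "g ** X ** matrix_inv g \<in> lie_algebra G"
  unfolding lie_algebra_def
proof (intro CollectI ballI impI)
  fix f :: "'a cmat \<Rightarrow> complex" assume f: "f \<in> polynomial_functions entries" "\<forall>A\<in>G. f A = 0"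
  define \<phi> where "\<phi> A = g ** A ** matrix_inv g" for A
  have "(\<lambda>A. f (\<phi> A)) \<in> polynomial_functions entries"
    using f(1)
  proof (rule polynomial_functions_compose)
    fix c :: "'a cmat \<Rightarrow> complex" assume "c \<in> entries"
    then obtain i j where "c = (\<lambda>A. A $ i $ j)" by (auto simp: entries_def)
    then show "(\<lambda>A. c (\<phi> A)) \<in> polynomial_functions entries"
      by (simp add: \<phi>_def conj_polynomial)
  qed
  moreover have "\<forall>A\<in>G. f (\<phi> A) = 0"
    using f(2) algebraic_groupD(3,4)[OF G] g by (simp add: \<phi>_def)
  ultimately have "((\<lambda>t. f (\<phi> (mat 1 + cscale t X))) has_field_derivative 0) (at 0)"
    using X by (auto simp: lie_algebra_def)
  moreover have "\<phi> (mat 1 + cscale t X) = mat 1 + cscale t (g ** X ** matrix_inv g)" for t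
    using matrix_inv_cancel(1)[OF algebraic_groupD(2)[OF G g]]
    by (simp add: \<phi>_def clinear_add[OF clinear_conj] clinear_cscale[OF clinear_conj])
  ultimately show "((\<lambda>t. f (mat 1 + cscale t (g ** X ** matrix_inv g))) has_field_derivative 0) (at 0)"
    by simp
qed

lemma fixed_inverse:
  assumes G: "algebraic_group G" and hom: "\<theta> \<in> hom (GL_sub G) (GL_sub G)"
  shows "\<theta> (mat 1) = mat 1" "g \<in> G \<Longrightarrow> \<theta> g = g \<Longrightarrow> \<theta> (matrix_inv g) = matrix_inv g"
proof -
  note [simp] = algebraic_groupD[OF G]
  have mult: "\<theta> (A ** B) = \<theta> A ** \<theta> B" "\<theta> A \<in> G" if "A \<in> G" "B \<in> G" for A B
    using hom that by (auto simp: hom_def GL_def)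
  (* An idempotent element of a group is the identity. *)
  have "\<theta> (mat 1) ** \<theta> (mat 1) = \<theta> (mat 1)"
    using mult(1)[of "mat 1" "mat 1"] by simp
  then have "matrix_inv (\<theta> (mat 1)) ** \<theta> (mat 1) ** \<theta> (mat 1) = matrix_inv (\<theta> (mat 1)) ** \<theta> (mat 1)"
    by (simp add: matrix_mul_assoc[symmetric])
  then show one: "\<theta> (mat 1) = mat 1"
    using matrix_inv_cancel(2)[of "\<theta> (mat 1)"] mult(2)[of "mat 1" "mat 1"] by simp
  assume g: "g \<in> G" "\<theta> g = g"
  have "\<theta> (matrix_inv g) ** g = mat 1"
    using mult(1)[of "matrix_inv g" g] g one matrix_inv_cancel(2)[of g] by simp
  then have "\<theta> (matrix_inv g) ** (g ** matrix_inv g) = matrix_inv g"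
    by (simp add: matrix_mul_assoc)
  then show "\<theta> (matrix_inv g) = matrix_inv g"
    using matrix_inv_cancel(1)[of g] g by simp
qed

text \<open>Let \<open>F\<close> extend \<open>\<theta>\<close>. If \<open>\<theta>\<close> fixes \<open>g\<close>, then the regular maps \<open>A \<mapsto> F (g A g\<inverse>)\<close> and
  \<open>A \<mapsto> g (F A) g\<inverse>\<close> agree on \<open>G\<close>, so they have the same differential on the Lie algebra.\<close>

lemma anti_invariants_conj:
  assumes pair: "reductive_symmetric_pair G \<theta>" and g: "g \<in> G" "\<theta> g = g"
    and X: "X \<in> anti_invariants G \<theta>"
  shows "g ** X ** matrix_inv g \<in> anti_invariants G \<theta>"
proof -
  have G: "algebraic_group G" and hom: "\<theta> \<in> hom (GL_sub G) (GL_sub G)"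
    and ext: "\<exists>F. regular_extension G \<theta> F"
    using pair by (auto simp: reductive_symmetric_pair_def reductive_group_def)
  define h where "h = matrix_inv g"
  have inv: "invertible g" using algebraic_groupD(2)[OF G g(1)] .
  have h: "h \<in> G" "\<theta> h = h" "g ** h = mat 1"
    using algebraic_groupD(4)[OF G g(1)] fixed_inverse(2)[OF G hom g] matrix_inv_cancel(1)[OF inv]
    by (simp_all add: h_def)
  obtain F D where F: "regular_extension G \<theta> F"
    and D: "\<And>i j. has_differential (\<lambda>A. F A $ i $ j) (D i j)"
    and d: "\<And>X. differential G \<theta> X = (\<chi> i j. D i j X)"
    using differential_expansion[OF ext] by metis
  have F_reg: "(\<lambda>A. F A $ i $ j) \<in> regular_functions" and F_eq: "A \<in> G \<Longrightarrow> F A = \<theta> A" for i j A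
    using F by (auto simp: regular_extension_def)
  have X_lie: "X \<in> lie_algebra G" and X_anti: "(\<chi> i j. D i j X) = - X"
    using X by (auto simp: anti_invariants_def d)
  have expand: "(g ** M ** h) $ i $ j = (\<Sum>b\<in>UNIV. (\<Sum>a\<in>UNIV. (g $ i $ a * h $ b $ j) * M $ a $ b))"
    for M i j
    by (simp add: matrix_matrix_mult_def sum_distrib_left sum_distrib_right mult_ac)
  have "D i j (g ** X ** h) = (g ** (\<chi> i j. D i j X) ** h) $ i $ j" for i j
  proof -
    define f where "f A = F (g ** A ** h) $ i $ j + (-1) * (g ** F A ** h) $ i $ j" for A
    have reg1: "(\<lambda>A. F (g ** A ** h) $ i $ j) \<in> regular_functions"
      using conj_regular[OF F_reg inv] by (simp add: h_def)
    have reg2: "(\<lambda>A. (g ** F A ** h) $ i $ j) \<in> regular_functions"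
      unfolding expand regular_functions_def
      by (intro polynomial_functions_sum polynomial_functions.mult polynomial_functions.const
          F_reg[unfolded regular_functions_def])
    have f: "f \<in> regular_functions"
      unfolding f_def regular_functions_def
      by (intro polynomial_functions.add polynomial_functions.mult polynomial_functions.const
          reg1[unfolded regular_functions_def] reg2[unfolded regular_functions_def])
    have f0: "f A = 0" if "A \<in> G" for A
    proof -
      have "\<theta> (g ** A ** h) = g ** \<theta> A ** h"
        using hom that g h algebraic_groupD(3)[OF G] by (simp add: hom_def GL_def)
      then show ?thesis
        using that g h algebraic_groupD(3)[OF G] by (simp add: f_def F_eq)
    qed
    have "g ** (mat 1 + cscale t Y) ** h = mat 1 + cscale t (g ** Y ** h)" for t Y
      by (simp add: clinear_add[OF clinear_conj] clinear_cscale[OF clinear_conj] h(3))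
    then have D1: "has_differential (\<lambda>A. F (g ** A ** h) $ i $ j) (\<lambda>Y. D i j (g ** Y ** h))"
      using has_differentialD[OF D]
      by (simp add: has_differential_def clinear_add[OF clinear_conj] clinear_cscale[OF clinear_conj])
    have D2: "has_differential (\<lambda>A. (g ** F A ** h) $ i $ j)
        (\<lambda>Y. (g ** (\<chi> i j. D i j Y) ** h) $ i $ j)"
      unfolding expand vec_lambda_beta
      by (intro has_differential_sum has_differential_cmult D)
    have "D i j (g ** X ** h) + (-1) * (g ** (\<chi> i j. D i j X) ** h) $ i $ j = 0"
      by (rule regular_function_differential_vanishes[OF G f f0 _ X_lie])
        (simp_all only: f_def has_differential_add[OF D1 has_differential_cmult[OF D2]])
    then show ?thesis by simp
  qed
  then have "differential G \<theta> (g ** X ** h) = g ** (- X) ** h"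
    unfolding d X_anti by (simp add: vec_eq_iff)
  also have "\<dots> = - (g ** X ** h)"
    by (rule cmat_pair.linear_neg[OF clinear_conj])
  finally show ?thesis
    using lie_algebra_conj[OF G g(1) X_lie] by (simp add: anti_invariants_def h_def)
qed

lemma fixed_group_subset: "fixed_group G \<theta> \<subseteq> {A \<in> G. \<theta> A = A}"
  unfolding fixed_group_def identity_component_def
  using connected_component_of_subset_topspace[of "subtopology zariski_mat {A \<in> G. \<theta> A = A}"]
  by simp

lemma fixed_group_invertible:
  assumes "reductive_symmetric_pair G \<theta>" "g \<in> fixed_group G \<theta>"
  shows "invertible g"
proof -
  have "algebraic_group G"
    using assms(1) by (simp add: reductive_symmetric_pair_def reductive_group_def)
  moreover have "g \<in> G" using assms(2) fixed_group_subset by blast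
  ultimately show ?thesis by (rule algebraic_groupD(2))
qed

lemma one_in_fixed_group:
  assumes "reductive_symmetric_pair G \<theta>"
  shows "mat 1 \<in> fixed_group G \<theta>"
proof -
  have G: "algebraic_group G" and hom: "\<theta> \<in> hom (GL_sub G) (GL_sub G)"
    using assms by (auto simp: reductive_symmetric_pair_def reductive_group_def)
  show ?thesis
    using algebraic_groupD(1)[OF G] fixed_inverse(1)[OF G hom]
    by (simp add: fixed_group_def identity_component_def connected_component_of_refl)
qed


section \<open>Open sets of the Grassmannian\<close>

lemma span_of_frame:
  assumes "v \<in> frames r V"
  shows "cmat.span (v ` {..<r}) = range (\<lambda>t. \<Sum>k<r. cscale (t k) (v k))"
proof -
  have inj: "inj_on v {..<r}" using assms by (simp add: frames_def)
  have "cmat.span (v ` {..<r}) = range (\<lambda>t. \<Sum>k<r. cscale (t (v k)) (v k))"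
    by (simp add: cmat.span_finite sum.reindex[OF inj] o_def)
  also have "\<dots> = range (\<lambda>t. \<Sum>k<r. cscale (t k) (v k))"
  proof (intro equalityI subsetI)
    fix x assume "x \<in> range (\<lambda>t. \<Sum>k<r. cscale (t k) (v k))"
    then obtain t where "x = (\<Sum>k<r. cscale (t k) (v k))" by blast
    also have "\<dots> = (\<Sum>k<r. cscale (t (the_inv_into {..<r} v (v k))) (v k))"
      by (rule sum.cong) (simp_all add: the_inv_into_f_f[OF inj])
    finally show "x \<in> range (\<lambda>t. \<Sum>k<r. cscale (t (v k)) (v k))"
      by (intro image_eqI[of _ _ "\<lambda>y. t (the_inv_into {..<r} v y)"]) simp_all
  qed auto
  finally show ?thesis .
qed

lemma span_of_frame_in_grassmannian:
  assumes "cmat.subspace V" "v \<in> frames r V"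
  shows "cmat.span (v ` {..<r}) \<in> grassmannian r V"
proof -
  have "v ` {..<r} \<subseteq> V" "inj_on v {..<r}" "cmat.independent (v ` {..<r})"
    using assms(2) by (auto simp: frames_def)
  then show ?thesis
    using assms(1)
    by (simp add: grassmannian_def cmat.span_minimal cmat.dim_eq_card_independent card_image)
qed

lemma frame_combination_polynomial:
  "(\<lambda>v. (\<Sum>k<r. cscale (t k) (v k)) $ i $ j) \<in> polynomial_functions (frame_entries r)"
  unfolding sum_component cscale_nth
  by (intro polynomial_functions_sum polynomial_functions.mult polynomial_functions.const
      polynomial_functions.coord) (auto simp: frame_entries_def)

lemma openin_grassmannI:
  assumes "S \<subseteq> grassmannian r V" and Q: "Q \<subseteq> polynomial_functions (frame_entries r)"
    and "\<And>v. v \<in> frames r V \<Longrightarrow> cmat.span (v ` {..<r}) \<in> S \<longleftrightarrow> (\<exists>q\<in>Q. q v \<noteq> 0)"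
  shows "openin (grassmann_topology r V) S"
proof -
  have "{v \<in> frames r V. cmat.span (v ` {..<r}) \<in> S} = frames r V \<inter> (\<Union>q\<in>Q. {v. q v \<noteq> 0})"
    using assms(3) by blast
  moreover have "openin (zariski (frame_entries r)) (\<Union>q\<in>Q. {v. q v \<noteq> 0})"
    using Q by (intro openin_Union) (auto intro: openin_zariski_nonzero)
  ultimately show ?thesis
    unfolding openin_grassmann_topology using assms(1) by (simp add: openin_subtopology_Int2)
qed

lemma topspace_grassmann: "topspace (grassmann_topology r V) \<subseteq> grassmannian r V"
  using openin_topspace[of "grassmann_topology r V"] unfolding openin_grassmann_topology by blast

text \<open>A point of the span of a frame is a combination of the frame with constant coefficients; for
  each choice of these, the condition is polynomial in the frame.\<close>

lemma openin_grassmann_meets: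
  assumes V: "cmat.subspace V" and f: "f \<in> polynomial_functions entries"
  shows "openin (grassmann_topology r V) {W \<in> grassmannian r V. \<exists>x\<in>W. f x \<noteq> 0}"
proof (rule openin_grassmannI)
  let ?Q = "range (\<lambda>t v. f (\<Sum>k<r. cscale (t k) (v k)))"
  show "?Q \<subseteq> polynomial_functions (frame_entries r)"
  proof clarify
    fix t
    show "(\<lambda>v. f (\<Sum>k<r. cscale (t k) (v k))) \<in> polynomial_functions (frame_entries r)"
      using f
    proof (rule polynomial_functions_compose)
      fix c :: "'a cmat \<Rightarrow> complex" assume "c \<in> entries"
      then obtain i j where "c = (\<lambda>A. A $ i $ j)" by (auto simp: entries_def)
      then show "(\<lambda>v. c (\<Sum>k<r. cscale (t k) (v k))) \<in> polynomial_functions (frame_entries r)"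
        by (simp only: frame_combination_polynomial)
    qed
  qed
  show "cmat.span (v ` {..<r}) \<in> {W \<in> grassmannian r V. \<exists>x\<in>W. f x \<noteq> 0} \<longleftrightarrow> (\<exists>q\<in>?Q. q v \<noteq> 0)"
    if "v \<in> frames r V" for v
    using span_of_frame_in_grassmannian[OF V that] by (simp add: span_of_frame[OF that])
qed blast

lemma openin_grassmann_noncommuting:
  assumes V: "cmat.subspace V"
  shows "openin (grassmann_topology r V) {W \<in> grassmannian r V. \<exists>x\<in>W. \<exists>y\<in>W. bracket x y \<noteq> 0}"
proof (rule openin_grassmannI)
  define q where "q = (\<lambda>(s, t, i, j) v.
    bracket (\<Sum>k<r. cscale (s k) (v k)) (\<Sum>k<r. cscale (t k) (v k :: 'a cmat)) $ i $ j)"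
  show "range q \<subseteq> polynomial_functions (frame_entries r)"
    by (auto simp: q_def intro!: bracket_polynomial frame_combination_polynomial)
  show "cmat.span (v ` {..<r}) \<in> {W \<in> grassmannian r V. \<exists>x\<in>W. \<exists>y\<in>W. bracket x y \<noteq> 0} \<longleftrightarrow>
      (\<exists>q\<in>range q. q v \<noteq> 0)" if "v \<in> frames r V" for v
    using span_of_frame_in_grassmannian[OF V that]
    by (simp add: span_of_frame[OF that] q_def vec_eq_iff split_paired_Ex)
qed blast

lemma closure_of_meets_openin:
  "x \<in> T closure_of S \<Longrightarrow> openin T U \<Longrightarrow> x \<in> U \<Longrightarrow> \<exists>y\<in>S. y \<in> U"
  by (auto simp: in_closure_of)

text \<open>Cartan subspaces lie in toral subalgebras, and commuting is a closed condition.\<close>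

lemma reductions_commute:
  assumes pair: "reductive_symmetric_pair G \<theta>" and W: "W \<in> reductions G \<theta>"
    and xy: "x \<in> W" "y \<in> W"
  shows "bracket x y = 0"
proof (rule ccontr)
  assume "bracket x y \<noteq> 0"
  let ?S = "{W \<in> grassmannian (pair_rank G \<theta>) (anti_invariants G \<theta>).
    \<exists>x\<in>W. \<exists>y\<in>W. bracket x y \<noteq> 0}"
  have W': "W \<in> topspace (pair_grassmann_topology G \<theta>)"
    using W by (simp add: reductions_def in_closure_of)
  then have in_S: "W \<in> ?S"
    using xy \<open>bracket x y \<noteq> 0\<close> topspace_grassmann by (auto simp: pair_grassmann_topology_def)
  have open_S: "openin (pair_grassmann_topology G \<theta>) ?S"
    unfolding pair_grassmann_topology_def
    by (rule openin_grassmann_noncommuting[OF anti_invariants_subspace[OF pair]])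
  obtain A where "cartan_subspace G \<theta> A" "A \<in> ?S"
    using closure_of_meets_openin[OF W[unfolded reductions_def] open_S in_S] by blast
  then obtain H where "A \<subseteq> H" "\<forall>X\<in>H. \<forall>Y\<in>H. bracket X Y = 0"
    by (auto simp: cartan_subspace_def in_p_and_cartan_def cartan_subalgebra_def
        toral_subalgebra_def)
  then show False using \<open>A \<in> ?S\<close> by blast
qed


section \<open>Regular elements near a regular element\<close>

lemma regular_elements_open:
  assumes pair: "reductive_symmetric_pair G \<theta>" and u: "u \<in> regular_elements G \<theta>"
  shows "\<exists>f\<in>polynomial_functions entries. f u \<noteq> 0 \<and>
    (\<forall>x\<in>anti_invariants G \<theta>. f x \<noteq> 0 \<longrightarrow> x \<in> regular_elements G \<theta>)"
proof -
  have "\<exists>f\<in>polynomial_functions entries. f u \<noteq> 0 \<and> (\<forall>x. f x \<noteq> 0 \<longrightarrow>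
      cmat.dim {X \<in> anti_invariants G \<theta>. bracket X x = 0}
        \<le> cmat.dim {X \<in> anti_invariants G \<theta>. bracket X u = 0})"
    by (rule kernel_dim_semicontinuous[OF clinear_bracket _ anti_invariants_subspace[OF pair]])
      (rule bracket_polynomial[OF polynomial_functions.const entry_polynomial])
  then obtain f where f: "f \<in> polynomial_functions entries" "f u \<noteq> 0"
    "\<And>x. f x \<noteq> 0 \<Longrightarrow> cmat.dim (centralizer_p G \<theta> x) \<le> cmat.dim (centralizer_p G \<theta> u)"
    unfolding centralizer_p_def by blast
  have "x \<in> regular_elements G \<theta>" if "x \<in> anti_invariants G \<theta>" "f x \<noteq> 0" for x
    using f(3)[OF that(2)] u that(1) by (auto simp: regular_elements_def intro: order_trans)
  then show ?thesis using f(1,2) by blast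
qed

lemma centralizer_p_subspace:
  assumes "reductive_symmetric_pair G \<theta>"
  shows "cmat.subspace (centralizer_p G \<theta> u)"
proof -
  have "centralizer_p G \<theta> u = anti_invariants G \<theta> \<inter> {X. bracket X u = 0}"
    by (auto simp: centralizer_p_def)
  then show ?thesis
    using cmat.subspace_inter[OF anti_invariants_subspace[OF assms]
        cmat_pair.linear_subspace_kernel[OF clinear_bracket[of u]]] by simp
qed

text \<open>Commutativity places \<open>W\<close> inside the centralizer of \<open>x\<close>, and the dimension leaves no room for
  more.\<close>

lemma commuting_eq_centralizer:
  assumes pair: "reductive_symmetric_pair G \<theta>"
    and W: "W \<in> grassmannian r (anti_invariants G \<theta>)" "\<And>x y. x \<in> W \<Longrightarrow> y \<in> W \<Longrightarrow> bracket x y = 0"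
    and x: "x \<in> W" "cmat.dim (centralizer_p G \<theta> x) \<le> r"
  shows "centralizer_p G \<theta> x = W"
proof -
  have "W \<subseteq> centralizer_p G \<theta> x"
    using W x(1) by (auto simp: grassmannian_def centralizer_p_def)
  moreover have "cmat.subspace W" "cmat.dim W = r"
    using W(1) by (simp_all add: grassmannian_def)
  ultimately show ?thesis
    using cmat_fd.subspace_dim_equal[OF _ centralizer_p_subspace[OF pair]] x(2) by blast
qed

text \<open>Conjugation embeds the centralizer of \<open>y\<close> into that of its conjugate, whose dimension is
  minimal.\<close>

lemma regular_element_conj:
  assumes pair: "reductive_symmetric_pair G \<theta>" and g: "g \<in> fixed_group G \<theta>"
    and y: "y \<in> anti_invariants G \<theta>"
    and reg: "g ** y ** matrix_inv g \<in> regular_elements G \<theta>"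
  shows "y \<in> regular_elements G \<theta>"
proof -
  let ?c = "\<lambda>X. g ** X ** matrix_inv g"
  have gG: "g \<in> G" "\<theta> g = g" using g fixed_group_subset by blast+
  have inv: "invertible g"
    using fixed_group_invertible[OF pair g] .
  have "?c ` centralizer_p G \<theta> y \<subseteq> centralizer_p G \<theta> (?c y)"
    using anti_invariants_conj[OF pair gG] cmat_pair.linear_0[OF clinear_conj]
    by (auto simp: centralizer_p_def bracket_conj[OF inv])
  then have "cmat.dim (centralizer_p G \<theta> y) \<le> cmat.dim (centralizer_p G \<theta> (?c y))"
    using cmat_fd.dim_subset dim_image_conj[OF inv] by metis
  then show ?thesis
    using reg y by (auto simp: regular_elements_def intro: order_trans)
qed

text \<open>Let \<open>f\<close> cut out a neighbourhood of \<open>u\<close> consisting of regular elements. The subspaces that meet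
  the locus \<open>f h \<noteq> 0\<close> form a neighbourhood of the centralizer of \<open>u\<close>, hence include some \<open>W\<close> in the
  orbit \<open>R\<close>; this \<open>W\<close> is the centralizer of any of its regular elements. The orbit is regular since
  the same then holds for the reduction \<open>W1\<close> that generates it: \<open>W\<close> itself is only known to be a
  conjugate of a reduction.\<close>

lemma regular_elements_near_centralizer:
  assumes pair: "reductive_symmetric_pair G \<theta>" and R: "R \<in> reduction_orbits G \<theta>"
    and u: "u \<in> regular_elements G \<theta>"
    and cl: "centralizer_p G \<theta> u \<in> pair_grassmann_topology G \<theta> closure_of R"
    and h: "h \<in> polynomial_functions entries" "h u \<noteq> 0"
  shows "\<exists>x\<in>associated_class G \<theta> R. h x \<noteq> 0"
    and "regular_orbit G \<theta> R"
proof -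
  let ?p = "anti_invariants G \<theta>" and ?r = "pair_rank G \<theta>"
  obtain f where f: "f \<in> polynomial_functions entries" "f u \<noteq> 0"
    "\<forall>x\<in>?p. f x \<noteq> 0 \<longrightarrow> x \<in> regular_elements G \<theta>"
    using regular_elements_open[OF pair u] by blast
  have cu: "centralizer_p G \<theta> u \<in> grassmannian ?r ?p"
    using cl topspace_grassmann[of ?r ?p] by (auto simp: in_closure_of pair_grassmann_topology_def)
  let ?U = "{W \<in> grassmannian ?r ?p. \<exists>x\<in>W. f x * h x \<noteq> 0}"
  have open_U: "openin (pair_grassmann_topology G \<theta>) ?U"
    unfolding pair_grassmann_topology_def
    by (intro openin_grassmann_meets anti_invariants_subspace[OF pair] polynomial_functions.mult f h)
  have "u \<in> centralizer_p G \<theta> u"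
    using u by (simp add: regular_elements_def centralizer_p_def bracket_def)
  then have in_U: "centralizer_p G \<theta> u \<in> ?U"
    using cu f(2) h(2) by auto
  obtain W where W: "W \<in> R" "W \<in> ?U"
    using closure_of_meets_openin[OF cl open_U in_U] by blast
  then obtain x where x: "x \<in> W" "f x \<noteq> 0" "h x \<noteq> 0" by auto
  have Wp: "W \<subseteq> ?p" "cmat.dim W = ?r" using W(2) by (auto simp: grassmannian_def)
  have x_reg: "x \<in> regular_elements G \<theta>" using f(3) x Wp(1) by blast
  (* All regular elements have centralizers of the dimension that occurs at u, which is the rank. *)
  have dim_reg: "cmat.dim (centralizer_p G \<theta> y) \<le> ?r" if "y \<in> regular_elements G \<theta>" for y
    using that u cu by (auto simp: regular_elements_def grassmannian_def)
  obtain W1 where W1: "W1 \<in> reductions G \<theta>"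
    and R_eq: "R = {conj_action g W1 | g. g \<in> fixed_group G \<theta>}"
    using R by (auto simp: reduction_orbits_def orbits_def orbit_def)
  obtain g where g: "g \<in> fixed_group G \<theta>" and W_eq: "W = conj_action g W1"
    using W(1) R_eq by blast
  have inv: "invertible g"
    using fixed_group_invertible[OF pair g] .
  have W_comm: "bracket a b = 0" if "a \<in> W" "b \<in> W" for a b
    using that reductions_commute[OF pair W1] cmat_pair.linear_0[OF clinear_conj]
    by (auto simp: W_eq conj_action_def bracket_conj[OF inv])
  have "centralizer_p G \<theta> x = W"
    using commuting_eq_centralizer[OF pair _ W_comm x(1) dim_reg[OF x_reg]] W(2) by blast
  then show "\<exists>x\<in>associated_class G \<theta> R. h x \<noteq> 0"
    using W(1) x_reg x(3) by (auto simp: associated_class_def)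
  have W1_gr: "W1 \<in> grassmannian ?r ?p"
    using W1 topspace_grassmann[of ?r ?p]
    by (auto simp: reductions_def in_closure_of pair_grassmann_topology_def)
  obtain y where y: "y \<in> W1" "x = g ** y ** matrix_inv g"
    using x(1) by (auto simp: W_eq conj_action_def)
  have y_reg: "y \<in> regular_elements G \<theta>"
    using regular_element_conj[OF pair g] y x_reg W1_gr by (auto simp: grassmannian_def)
  have "centralizer_p G \<theta> y = W1"
    using commuting_eq_centralizer[OF pair W1_gr reductions_commute[OF pair W1] y(1) dim_reg[OF y_reg]] .
  then have "W1 \<in> regular_reductions G \<theta>"
    using W1 y_reg by (auto simp: regular_reductions_def)
  moreover have "W1 \<in> R"
  proof -
    have "matrix_inv (mat 1 :: 'a cmat) = mat 1"
      using matrix_inv_cancel(1)[of "mat 1 :: 'a cmat"] by (simp add: invertible_def)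
    then have "conj_action (mat 1) W1 = W1" by (simp add: conj_action_def)
    then show ?thesis using R_eq one_in_fixed_group[OF pair] by force
  qed
  ultimately show "regular_orbit G \<theta> R" by (auto simp: regular_orbit_def)
qed

theorem proposition3p9:
  fixes G :: "(complex ^ 'n::finite ^ 'n) set"
    and \<theta> :: "complex ^ 'n ^ 'n \<Rightarrow> complex ^ 'n ^ 'n"
    and R\<^sub>I R\<^sub>I\<^sub>I :: "(complex ^ 'n ^ 'n) set set"
  assumes "reductive_symmetric_pair G \<theta>"
    and "R\<^sub>I \<in> reduction_orbits G \<theta>"
    and "R\<^sub>I\<^sub>I \<in> reduction_orbits G \<theta>"
    and "orbit_more_general G \<theta> R\<^sub>I R\<^sub>I\<^sub>I"
    and "regular_orbit G \<theta> R\<^sub>I\<^sub>I"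
  shows "regular_orbit G \<theta> R\<^sub>I \<and>
    class_more_general G \<theta> (associated_class G \<theta> R\<^sub>I) (associated_class G \<theta> R\<^sub>I\<^sub>I)"
proof
  have cl: "W \<in> pair_grassmann_topology G \<theta> closure_of R\<^sub>I" if "W \<in> R\<^sub>I\<^sub>I" for W
    using assms(4) that by (auto simp: orbit_more_general_def)
  obtain u where "u \<in> regular_elements G \<theta>" "centralizer_p G \<theta> u \<in> R\<^sub>I\<^sub>I"
    using assms(5) by (auto simp: regular_orbit_def regular_reductions_def)
  then show "regular_orbit G \<theta> R\<^sub>I"
    using regular_elements_near_centralizer(2)[OF assms(1,2) _ cl polynomial_functions.const, of u 1]
    by simp
  show "class_more_general G \<theta> (associated_class G \<theta> R\<^sub>I) (associated_class G \<theta> R\<^sub>I\<^sub>I)"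
    unfolding class_more_general_def
  proof
    fix u assume "u \<in> associated_class G \<theta> R\<^sub>I\<^sub>I"
    then have u: "u \<in> regular_elements G \<theta>" "centralizer_p G \<theta> u \<in> R\<^sub>I\<^sub>I"
      by (auto simp: associated_class_def)
    let ?T = "subtopology zariski_mat (anti_invariants G \<theta>)"
    have "u \<in> topspace ?T" using u(1) by (simp add: regular_elements_def)
    moreover have "\<exists>y\<in>associated_class G \<theta> R\<^sub>I. y \<in> U" if U: "u \<in> U" "openin ?T U" for U
    proof -
      obtain U' where U': "openin zariski_mat U'" "U = U' \<inter> anti_invariants G \<theta>"
        using U(2) by (auto simp: openin_subtopology)
      obtain h where h: "h \<in> polynomial_functions entries" "h u \<noteq> 0" "{y. h y \<noteq> 0} \<subseteq> U'"
        using zariski_base[OF U'(1), of u] U(1) U'(2) by blast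
      obtain x where "x \<in> associated_class G \<theta> R\<^sub>I" "h x \<noteq> 0"
        using regular_elements_near_centralizer(1)[OF assms(1,2) u(1) cl[OF u(2)] h(1,2)] by blast
      moreover from this have "x \<in> anti_invariants G \<theta>"
        by (simp add: associated_class_def regular_elements_def)
      ultimately show ?thesis using U'(2) h(3) by blast
    qed
    ultimately show "u \<in> ?T closure_of associated_class G \<theta> R\<^sub>I"
      unfolding in_closure_of by blast
  qed
qed

end
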